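(* Let $a<b$ be real, $r,\delta,\beta,\sigma>0$, $\alpha\in(0,1)$ with $\delta>\alpha r+\frac{\alpha(a-b)^2}{2(1-\alpha)}$, and let $\pi=\frac{\theta x_+(a)}{\sigma}$ be as defined in the context. Then (each time varying one quantity with the other parameters fixed, within the range where the inequality $\delta>\alpha r+\frac{\alpha(a-b)^2}{2(1-\alpha)}$ holds): 1. $\pi$ is decreasing with respect to $\sigma$. 2. $\pi$ is decreasing with respect to $1-\alpha$. 3. Let $\hat\delta:=\beta+\frac{\delta-r}{\alpha-1}$. Then: (i) if $\hat\delta\ge0$, then $\pi$ is increasing with respect to $b-a$; (ii) if $\hat\delta<0$ and $\delta-2\alpha\delta+\alpha^2r+\beta\alpha(1-\alpha)\le0$, then $\pi$ is decreasing with respect to $b-a$; (iii) if $\hat\delta<0$ and $\delta-2\alpha\delta+\alpha^2r+\beta\alpha(1-\alpha)>0$, then $\pi$ is decreasing with respect to $b-a$ when $(b-a)^2\in(0,-2(1-\alpha)\hat\delta)$ and increasing when $(b-a)^2\in\big(-2(1-\alpha)\hat\delta,\,(1-\alpha)\frac{2(\delta-\alpha r)}{\alpha}\big)$.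
   Context: $\theta:=\frac{b-a}{1-\alpha}$, $\lambda:=\frac1{2(\alpha-1)}[(a^2-b^2)-2(\delta-r)]$, and $x_+(a)$ is the largest root of the quadratic equation $\frac12\theta^2x^2-(\lambda-\beta-\theta a)x-(r+\beta)=0$. (The quantity $\theta x_+(a)$ depends on $(a,b)$ only through $b-a$, so "monotone with respect to $b-a$" is meaningful.) $\pi$ is the constant fraction of wealth invested in the risky asset by the agent of the paper. *)

theory Defs
  imports Complex_Main
begin

definition theta :: "real \<Rightarrow> real \<Rightarrow> real \<Rightarrow> real" where
  "theta \<alpha> a b = (b - a) / (1 - \<alpha>)"

definition lam :: "real \<Rightarrow> real \<Rightarrow> real \<Rightarrow> real \<Rightarrow> real \<Rightarrow> real" where
  "lam \<alpha> r \<delta> a b = 1 / (2 * (\<alpha> - 1)) * ((a\<^sup>2 - b\<^sup>2) - 2 * (\<delta> - r))"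

definition x_plus :: "real \<Rightarrow> real \<Rightarrow> real \<Rightarrow> real \<Rightarrow> real \<Rightarrow> real \<Rightarrow> real" where
  "x_plus \<alpha> r \<delta> \<beta> a b =
     (GREATEST x. 1 / 2 * (theta \<alpha> a b)\<^sup>2 * x\<^sup>2
        - (lam \<alpha> r \<delta> a b - \<beta> - theta \<alpha> a b * a) * x - (r + \<beta>) = 0)"

definition risky_fraction :: "real \<Rightarrow> real \<Rightarrow> real \<Rightarrow> real \<Rightarrow> real \<Rightarrow> real \<Rightarrow> real \<Rightarrow> real" where
  "risky_fraction \<alpha> r \<delta> \<beta> \<sigma> a b = theta \<alpha> a b * x_plus \<alpha> r \<delta> \<beta> a b / \<sigma>"

definition admissible :: "real \<Rightarrow> real \<Rightarrow> real \<Rightarrow> real \<Rightarrow> real \<Rightarrow> bool" where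
  "admissible \<alpha> r \<delta> a b \<longleftrightarrow> \<delta> > \<alpha> * r + \<alpha> * (a - b)\<^sup>2 / (2 * (1 - \<alpha>))"

definition delta_hat :: "real \<Rightarrow> real \<Rightarrow> real \<Rightarrow> real \<Rightarrow> real" where
  "delta_hat \<alpha> r \<delta> \<beta> = \<beta> + (\<delta> - r) / (\<alpha> - 1)"

text \<open>
  Strict monotonicity on a parameter set P of f with respect to a real quantity q of the
  parameters, for instance q = 1 - \<alpha> or q = b - a.
\<close>

definition increasing_wrt :: "('p \<Rightarrow> real) \<Rightarrow> 'p set \<Rightarrow> ('p \<Rightarrow> real) \<Rightarrow> bool" where
  "increasing_wrt q P f \<longleftrightarrow> monotone_on P (\<lambda>x y. q x < q y) (<) f"

definition decreasing_wrt :: "('p \<Rightarrow> real) \<Rightarrow> 'p set \<Rightarrow> ('p \<Rightarrow> real) \<Rightarrow> bool" where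
  "decreasing_wrt q P f \<longleftrightarrow> monotone_on P (\<lambda>x y. q x < q y) (>) f"

text \<open>
  The risky fraction is a function of b - a, so its monotonicity with respect to b - a can be
  tested over all pairs (a, b) at once, without keeping a or b fixed.
\<close>

lemma risky_fraction_gap:
  fixes \<alpha> r \<delta> \<beta> \<sigma> a b a' b' :: real
  assumes "\<alpha> < 1" and gap: "b - a = b' - a'"
  shows "risky_fraction \<alpha> r \<delta> \<beta> \<sigma> a b = risky_fraction \<alpha> r \<delta> \<beta> \<sigma> a' b'"
proof -
  have *: "lam \<alpha> r \<delta> x y - \<beta> - theta \<alpha> x y * x
      = ((y - x)\<^sup>2 + 2 * (\<delta> - r)) / (2 * (1 - \<alpha>)) - \<beta>" for x y
  proof -
    have l: "lam \<alpha> r \<delta> x y = (y\<^sup>2 - x\<^sup>2 + 2 * (\<delta> - r)) / (2 * (1 - \<alpha>))"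
      using assms(1) unfolding lam_def by (simp add: divide_simps) (simp add: algebra_simps)
    have t: "theta \<alpha> x y * x = (2 * (y - x) * x) / (2 * (1 - \<alpha>))"
      using assms(1) unfolding theta_def by (simp add: divide_simps) (simp add: algebra_simps)
    show ?thesis
      unfolding l t by (simp add: diff_divide_distrib [symmetric])
        (simp add: algebra_simps power2_eq_square)
  qed
  have t: "theta \<alpha> a b = theta \<alpha> a' b'"
    by (simp add: theta_def gap)
  moreover have "x_plus \<alpha> r \<delta> \<beta> a b = x_plus \<alpha> r \<delta> \<beta> a' b'"
    unfolding x_plus_def * gap by (simp add: t)
  ultimately show ?thesis
    by (simp add: risky_fraction_def)
qed

end

theory Submission
  imports Defs
begin

text \<open>
  For d = b - a the number y = \<theta> x_+(a) is the positive root of y^2 - 2 m y = 2 (r + \<beta>) with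
  m = d/2 - K/d and K = (1 - \<alpha>) delta_hat = \<beta> (1 - \<alpha>) - (\<delta> - r), and this root is strictly
  increasing in m. So \<pi> inherits the monotonicity of m: since \<beta> > 0, m decreases with 1 - \<alpha>,
  while m(e) - m(d) = (e - d) (1/2 + K/(d e)) changes sign where (b - a)^2 crosses -2 K.
  The sign condition separating (ii) from (iii) compares -2 K with the admissible bound on (b - a)^2.
\<close>

definition drift_coeff :: "real \<Rightarrow> real \<Rightarrow> real" where
  "drift_coeff K d = d / 2 - K / d"

definition quad_root :: "real \<Rightarrow> real \<Rightarrow> real" where
  "quad_root p m = m + sqrt (m\<^sup>2 + p)"

lemma quad_root_pos:
  assumes "p > 0"
  shows "quad_root p m > 0"
proof -
  have "\<bar>m\<bar> < sqrt (m\<^sup>2 + p)"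
    using assms by (intro real_less_rsqrt) simp
  then show ?thesis
    by (simp add: quad_root_def)
qed

lemma quad_root_eq:
  assumes "p > 0"
  shows "(quad_root p m)\<^sup>2 - 2 * m * quad_root p m = p"
proof -
  have "(sqrt (m\<^sup>2 + p))\<^sup>2 = m\<^sup>2 + p"
    using assms by simp
  then show ?thesis
    unfolding quad_root_def by (simp add: power2_eq_square algebra_simps)
qed

text \<open>Completing the square bounds \<open>y - m\<close> by the square root whatever its sign.
  This is the maximality half of the \<open>GREATEST\<close> in \<open>x_plus\<close>.\<close>

lemma quad_root_greatest:
  assumes "y\<^sup>2 - 2 * m * y = p"
  shows "y \<le> quad_root p m"
proof -
  have "(y - m)\<^sup>2 \<le> m\<^sup>2 + p"
    using assms by (simp add: power2_eq_square algebra_simps)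
  then have "y - m \<le> sqrt (m\<^sup>2 + p)"
    by (rule real_le_rsqrt)
  then show ?thesis
    by (simp add: quad_root_def)
qed

text \<open>Dividing the equation by the positive root y gives 2 m = y - p / y. The right side is
  strictly increasing in y > 0, so a larger m forces a larger root; no derivative is taken.\<close>

lemma quad_root_strict_mono:
  assumes "p > 0"
  shows "strict_mono (quad_root p)"
proof (rule strict_monoI, rule ccontr)
  fix m n :: real
  assume "m < n" and "\<not> quad_root p m < quad_root p n"
  define y z where "y = quad_root p m" and "z = quad_root p n"
  have "0 < y" "0 < z" "z \<le> y"
    using \<open>\<not> _\<close> assms by (auto simp: y_def z_def quad_root_pos)
  have "y - 2 * m = p / y" "z - 2 * n = p / z"
    using quad_root_eq[OF assms, of m] quad_root_eq[OF assms, of n] \<open>0 < y\<close> \<open>0 < z\<close>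
    by (simp_all add: y_def z_def field_simps power2_eq_square)
  moreover have "p / y \<le> p / z"
    using assms \<open>0 < z\<close> \<open>z \<le> y\<close> by (intro divide_left_mono) auto
  ultimately show False
    using \<open>z \<le> y\<close> \<open>m < n\<close> by linarith
qed

text \<open>Clearing the denominator leaves an expression affine in 1 - \<alpha> with slope \<beta>,
  from which the dependence on \<alpha> can be read off.\<close>

lemma delta_hat_scaled:
  assumes "\<alpha> < 1"
  shows "(1 - \<alpha>) * delta_hat \<alpha> r \<delta> \<beta> = \<beta> * (1 - \<alpha>) - (\<delta> - r)"
  using assms by (simp add: delta_hat_def divide_simps) (simp add: algebra_simps)

text \<open>The substitution y = \<theta> x absorbs the factor \<theta>^2 and makes the quadratic
  monic up to a factor 1/2. The product \<theta> x_+(a) is then itself the larger root, with a and b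
  entering only through their gap.\<close>

lemma risky_fraction_eq:
  assumes "a < b" and "\<alpha> < 1" and "r + \<beta> > 0"
  shows "risky_fraction \<alpha> r \<delta> \<beta> \<sigma> a b =
    quad_root (2 * (r + \<beta>)) (drift_coeff ((1 - \<alpha>) * delta_hat \<alpha> r \<delta> \<beta>) (b - a)) / \<sigma>"
proof -
  define m where "m = drift_coeff ((1 - \<alpha>) * delta_hat \<alpha> r \<delta> \<beta>) (b - a)"
  define t where "t = theta \<alpha> a b"
  define p where "p = 2 * (r + \<beta>)"
  have "t > 0" "p > 0"
    using assms by (simp_all add: t_def p_def theta_def)
  have m: "m = ((b - a)\<^sup>2 - 2 * (\<beta> * (1 - \<alpha>) - (\<delta> - r))) / (2 * (b - a))"
    unfolding m_def drift_coeff_def delta_hat_scaled[OF \<open>\<alpha> < 1\<close>] using assms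
    by (simp add: divide_simps) (simp add: algebra_simps power2_eq_square)
  have "t * m = ((b - a)\<^sup>2 - 2 * (\<beta> * (1 - \<alpha>) - (\<delta> - r))) / (2 * (1 - \<alpha>))"
    unfolding m t_def theta_def using assms
    by (simp add: divide_simps) (simp add: algebra_simps)
  \<comment> \<open>The separate a and b disappear here: (b^2 - a^2) - 2 a (b - a) = (b -
    a)^2.\<close>
  also have "\<dots> = lam \<alpha> r \<delta> a b - \<beta> - t * a"
    unfolding lam_def t_def theta_def using assms
    by (simp add: divide_simps) (simp add: algebra_simps power2_eq_square)
  finally have lin: "lam \<alpha> r \<delta> a b - \<beta> - t * a = t * m" ..
  have quad: "1 / 2 * t\<^sup>2 * x\<^sup>2 - t * m * x - (r + \<beta>) = 0
      \<longleftrightarrow> (t * x)\<^sup>2 - 2 * m * (t * x) = p" for x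
    by (auto simp: p_def power_mult_distrib algebra_simps)
  have "x_plus \<alpha> r \<delta> \<beta> a b = quad_root p m / t"
    unfolding x_plus_def t_def[symmetric] lin quad
  \<comment> \<open>Since \<open>t > 0\<close>, scaling by \<open>t\<close> preserves order, so the
    greatest x corresponds to the greatest y = t x.\<close>
  proof (rule Greatest_equality)
    show "(t * (quad_root p m / t))\<^sup>2 - 2 * m * (t * (quad_root p m / t)) = p"
      using quad_root_eq[OF \<open>p > 0\<close>] \<open>t > 0\<close> by simp
  next
    fix x assume "(t * x)\<^sup>2 - 2 * m * (t * x) = p"
    from quad_root_greatest[OF this] show "x \<le> quad_root p m / t"
      using \<open>t > 0\<close> by (simp add: field_simps)
  qed
  then show ?thesis
    using \<open>t > 0\<close> by (simp add: risky_fraction_def t_def[symmetric] m_def p_def)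
qed

text \<open>Both sides share r, \<beta> and \<sigma>, hence the same p, so monotonicity of the root
  applies. Letting \<alpha> and the pair (a, b) differ serves the claims on 1 - \<alpha> and on b -
  a alike.\<close>

lemma risky_fraction_less_iff:
  assumes "a < b" "\<alpha> < 1" "a' < b'" "\<alpha>' < 1" "r + \<beta> > 0" "\<sigma> > 0"
  shows "risky_fraction \<alpha> r \<delta> \<beta> \<sigma> a b < risky_fraction \<alpha>' r \<delta> \<beta> \<sigma> a' b' \<longleftrightarrow>
    drift_coeff ((1 - \<alpha>) * delta_hat \<alpha> r \<delta> \<beta>) (b - a)
      < drift_coeff ((1 - \<alpha>') * delta_hat \<alpha>' r \<delta> \<beta>) (b' - a')"
  using assms strict_mono_less[OF quad_root_strict_mono, of "2 * (r + \<beta>)"]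
  by (simp add: risky_fraction_eq divide_less_cancel)

lemma drift_coeff_diff:
  assumes "0 < d" "0 < e"
  shows "drift_coeff K e - drift_coeff K d = (e - d) * (d * e + 2 * K) / (2 * (d * e))"
  using assms by (simp add: drift_coeff_def divide_simps) (simp add: algebra_simps)

text \<open>A bound at the smaller gap is enough: d e > d^2 \<ge> -2 K makes the factor d e + 2 K
  positive.\<close>

lemma drift_coeff_increasing:
  assumes "0 < d" "d < e" "- 2 * K \<le> d\<^sup>2"
  shows "drift_coeff K d < drift_coeff K e"
proof -
  have "d\<^sup>2 < d * e"
    using assms by (simp add: power2_eq_square)
  then have "0 < (e - d) * (d * e + 2 * K) / (2 * (d * e))"
    using assms by (intro divide_pos_pos mult_pos_pos) auto
  then show ?thesis
    using drift_coeff_diff[of d e K] assms by simp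
qed

text \<open>Dually, a bound at the larger gap gives d e < e^2 \<le> -2 K, so d e + 2 K is
  negative.\<close>

lemma drift_coeff_decreasing:
  assumes "0 < d" "d < e" "e\<^sup>2 \<le> - 2 * K"
  shows "drift_coeff K e < drift_coeff K d"
proof -
  have "e * d < e\<^sup>2"
    using assms by (simp add: power2_eq_square)
  then have "0 < (d - e) * (e * d + 2 * K) / (2 * (e * d))"
    using assms by (intro divide_pos_pos[OF mult_neg_neg]) auto
  then show ?thesis
    using drift_coeff_diff[of e d K] assms by simp
qed

theorem proposition6p9:
  fixes a b r \<delta> \<beta> \<sigma> \<alpha> :: real
  assumes "a < b"
    and "r > 0" and "\<delta> > 0" and "\<beta> > 0" and "\<sigma> > 0"
    and "0 < \<alpha>" and "\<alpha> < 1"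
    and "admissible \<alpha> r \<delta> a b"
  shows
    "decreasing_wrt (\<lambda>s. s) {s. s > 0} (\<lambda>s. risky_fraction \<alpha> r \<delta> \<beta> s a b)
     \<and> decreasing_wrt (\<lambda>\<gamma>. 1 - \<gamma>) {\<gamma>. 0 < \<gamma> \<and> \<gamma> < 1 \<and> admissible \<gamma> r \<delta> a b}
         (\<lambda>\<gamma>. risky_fraction \<gamma> r \<delta> \<beta> \<sigma> a b)
     \<and> (delta_hat \<alpha> r \<delta> \<beta> \<ge> 0 \<longrightarrow>
          increasing_wrt (\<lambda>(u, v). v - u) {(u, v). u < v \<and> admissible \<alpha> r \<delta> u v}
            (\<lambda>(u, v). risky_fraction \<alpha> r \<delta> \<beta> \<sigma> u v))
     \<and> (delta_hat \<alpha> r \<delta> \<beta> < 0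
          \<and> \<delta> - 2 * \<alpha> * \<delta> + \<alpha>\<^sup>2 * r + \<beta> * \<alpha> * (1 - \<alpha>) \<le> 0 \<longrightarrow>
          decreasing_wrt (\<lambda>(u, v). v - u) {(u, v). u < v \<and> admissible \<alpha> r \<delta> u v}
            (\<lambda>(u, v). risky_fraction \<alpha> r \<delta> \<beta> \<sigma> u v))
     \<and> (delta_hat \<alpha> r \<delta> \<beta> < 0
          \<and> \<delta> - 2 * \<alpha> * \<delta> + \<alpha>\<^sup>2 * r + \<beta> * \<alpha> * (1 - \<alpha>) > 0 \<longrightarrow>
          decreasing_wrt (\<lambda>(u, v). v - u)
            {(u, v). u < v \<and> admissible \<alpha> r \<delta> u v
               \<and> (v - u)\<^sup>2 \<in> {0 <..< - 2 * (1 - \<alpha>) * delta_hat \<alpha> r \<delta> \<beta>}}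
            (\<lambda>(u, v). risky_fraction \<alpha> r \<delta> \<beta> \<sigma> u v)
          \<and> increasing_wrt (\<lambda>(u, v). v - u)
            {(u, v). u < v \<and> admissible \<alpha> r \<delta> u v
               \<and> (v - u)\<^sup>2 \<in> {- 2 * (1 - \<alpha>) * delta_hat \<alpha> r \<delta> \<beta>
                               <..< (1 - \<alpha>) * (2 * (\<delta> - \<alpha> * r) / \<alpha>)}}
            (\<lambda>(u, v). risky_fraction \<alpha> r \<delta> \<beta> \<sigma> u v))"
proof (intro conjI impI, goal_cases)
  case 1
  \<comment> \<open>The numerator is positive and free of \<sigma>.\<close>
  have "risky_fraction \<alpha> r \<delta> \<beta> t a b < risky_fraction \<alpha> r \<delta> \<beta> s a b" if "0 < s" "s < t" for s t
    using assms that by (simp add: risky_fraction_eq divide_strict_left_mono quad_root_pos)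
  then show ?case
    by (auto simp: decreasing_wrt_def monotone_on_def)
next
  case 2
  have "risky_fraction \<gamma>' r \<delta> \<beta> \<sigma> a b < risky_fraction \<gamma> r \<delta> \<beta> \<sigma> a b"
    if "\<gamma> < 1" "\<gamma>' < 1" "1 - \<gamma> < 1 - \<gamma>'" for \<gamma> \<gamma>'
  proof -
    \<comment> \<open>With the gap fixed, only -K / (b - a) varies, and K grows with 1 - \<gamma> at
      rate \<beta> > 0.\<close>
    have "drift_coeff ((1 - \<gamma>') * delta_hat \<gamma>' r \<delta> \<beta>) (b - a)
        < drift_coeff ((1 - \<gamma>) * delta_hat \<gamma> r \<delta> \<beta>) (b - a)"
      using assms that by (simp add: delta_hat_scaled drift_coeff_def divide_strict_right_mono)
    then show ?thesis
      using assms that by (simp add: risky_fraction_less_iff)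
  qed
  then show ?case
    by (auto simp: decreasing_wrt_def monotone_on_def)
next
  case 3
  then have "0 \<le> (1 - \<alpha>) * delta_hat \<alpha> r \<delta> \<beta>"
    using assms by simp
  \<comment> \<open>Here -2 K \<le> 0, so the turning point lies below every squared gap.\<close>
  then have "- 2 * ((1 - \<alpha>) * delta_hat \<alpha> r \<delta> \<beta>) \<le> (v - u)\<^sup>2" for u v
    by (intro order_trans[OF _ zero_le_power2]) simp
  then show ?case
    using assms
    by (auto simp: increasing_wrt_def monotone_on_def risky_fraction_less_iff
        intro!: drift_coeff_increasing)
next
  case 4
  have "(v - u)\<^sup>2 \<le> - 2 * ((1 - \<alpha>) * delta_hat \<alpha> r \<delta> \<beta>)" if "admissible \<alpha> r \<delta> u v" for u v
  proof -
    have "\<alpha> * (v - u)\<^sup>2 / (2 * (1 - \<alpha>)) < \<delta> - \<alpha> * r"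
      using that by (simp add: admissible_def power2_commute)
    then have "\<alpha> * (v - u)\<^sup>2 < (\<delta> - \<alpha> * r) * (2 * (1 - \<alpha>))"
      using assms by (simp add: pos_divide_less_eq)
    \<comment> \<open>Up to the factor \<alpha>, the admissible bound on the squared gap exceeds -2
      K by twice the expression whose sign separates (ii) from (iii). When that is \<le> 0, every
      admissible gap stays before the turning point.\<close>
    also have "\<dots> = \<alpha> * (- 2 * (\<beta> * (1 - \<alpha>) - (\<delta> - r)))
        + 2 * (\<delta> - 2 * \<alpha> * \<delta> + \<alpha>\<^sup>2 * r + \<beta> * \<alpha> * (1 - \<alpha>))"
      by (simp add: algebra_simps power2_eq_square)
    also have "\<dots> \<le> \<alpha> * (- 2 * (\<beta> * (1 - \<alpha>) - (\<delta> - r)))"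
      using 4 by simp
    finally show ?thesis
      unfolding delta_hat_scaled[OF \<open>\<alpha> < 1\<close>] using assms by (simp only: mult_less_cancel_left_pos less_imp_le)
  qed
  then show ?case
    using assms
    by (auto simp: decreasing_wrt_def monotone_on_def risky_fraction_less_iff
        intro!: drift_coeff_decreasing)
next
  case 5
  \<comment> \<open>Naming K puts the interval endpoint in the form \<open>- 2 * K\<close> of the
    drift lemmas; the upper endpoint is applied to the larger gap.\<close>
  define K where "K = (1 - \<alpha>) * delta_hat \<alpha> r \<delta> \<beta>"
  have "- 2 * (1 - \<alpha>) * delta_hat \<alpha> r \<delta> \<beta> = - 2 * K"
    by (simp add: K_def algebra_simps)
  then show ?case
    using assms
    by (auto simp: decreasing_wrt_def monotone_on_def risky_fraction_less_iff K_def[symmetric]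
        intro!: drift_coeff_decreasing)
next
  case 6
  \<comment> \<open>Now -2 K is the lower endpoint, and it is applied to the smaller gap.\<close>
  define K where "K = (1 - \<alpha>) * delta_hat \<alpha> r \<delta> \<beta>"
  have "- 2 * (1 - \<alpha>) * delta_hat \<alpha> r \<delta> \<beta> = - 2 * K"
    by (simp add: K_def algebra_simps)
  then show ?case
    using assms
    by (auto simp: increasing_wrt_def monotone_on_def risky_fraction_less_iff K_def[symmetric]
        intro!: drift_coeff_increasing)
qed

end
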